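(* Let $F=\{F_{\varsigma}\}_{\varsigma\in\mathfrak{A}}$ be a redundant continuous frame for $\mathcal{H}$ with frame bounds $0<A_F\le B_F<\infty$ and frame operator $S_F$, such that $$\|I-S_F^{-1}\|^2<\frac{A_F}{B_F}.$$ Then there are infinitely many dual frames $G=\{G_{\varsigma}\}_{\varsigma\in\mathfrak{A}}$ of $F$ such that $\{F_{\varsigma}\}_{\varsigma\in\mathfrak{A}}$ and $\{G_{\varsigma}\}_{\varsigma\in\mathfrak{A}}$ are continuous woven.
   Context: $\mathcal{H}$ is a separable Hilbert space, $I$ its identity operator, and $(\mathfrak{A},\mu)$ a measure space with positive measure $\mu$. All families $\{F_\varsigma\}_{\varsigma\in\mathfrak{A}}\subset\mathcal{H}$ are such that $\varsigma\mapsto\langle f,F_\varsigma\rangle$ is measurable for each $f\in\mathcal{H}$; vector-valued integrals are understood weakly; subsets of $\mathfrak{A}$ and partitions are measurable; $K^C$ is the complement of $K$. A family $F=\{F_\varsigma\}_{\varsigma\in\mathfrak{A}}$ is a continuous frame for $\mathcal{H}$ with frame bounds $0<A_F\le B_F<\infty$ if $A_F\|f\|^2\le\int_{\mathfrak{A}}|\langle f,F_\varsigma\rangle|^2d\mu(\varsigma)\le B_F\|f\|^2$ for all $f\in\mathcal{H}$. Its frame operator is $S_Ff=\int_{\mathfrak{A}}\langle f,F_\varsigma\rangle F_\varsigma\,d\mu(\varsigma)$, a bounded, invertible, self-adjoint operator. $F$ is a continuous Riesz basis if $\overline{\mathrm{span}}\{F_\varsigma\}_{\varsigma\in\mathfrak{A}}=\mathcal{H}$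 and there are constants $0<A\le B<\infty$ with $A\int_{\mathfrak{A}}|\alpha_\varsigma|^2d\mu(\varsigma)\le\|\int_{\mathfrak{A}}\alpha_\varsigma F_\varsigma d\mu(\varsigma)\|^2\le B\int_{\mathfrak{A}}|\alpha_\varsigma|^2d\mu(\varsigma)$ for all $\{\alpha_\varsigma\}\in L^2(\mathfrak{A},\mu)$. A continuous frame is redundant if it is not a continuous Riesz basis. A continuous frame $\{G_\varsigma\}_{\varsigma\in\mathfrak{A}}$ is a dual frame of $F$ if $f=\int_{\mathfrak{A}}\langle f,G_\varsigma\rangle F_\varsigma\,d\mu(\varsigma)$ for all $f\in\mathcal{H}$. Two families $\{F_\varsigma\}$ and $\{G_\varsigma\}$ are continuous woven if there are universal constants $0<A\le B<\infty$ such that for every $K\subset\mathfrak{A}$ the family $\{F_\varsigma\}_{\varsigma\in K}\cup\{G_\varsigma\}_{\varsigma\in K^C}$ is a continuous frame for $\mathcal{H}$ with bounds $A$ and $B$, i.e. $A\|f\|^2\le\int_K|\langle f,F_\varsigma\rangle|^2d\mu(\varsigma)+\int_{K^C}|\langle f,G_\varsigma\rangle|^2d\mu(\varsigma)\le B\|f\|^2$ for all $f\in\mathcal{H}$. *)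

theory Defs
  imports "HOL-Analysis.Analysis"
begin

text \<open>
  The scalar field is \<^emph>\<open>either\<close> the reals or the complex numbers. The class below has no other
  models: a finite-dimensional commutative real division algebra is isomorphic to one of the two,
  a multiplicative norm on it is the usual absolute value, and then the last axiom forces the
  involution to be the identity on the reals and the usual conjugation on the complex numbers.
\<close>

class real_or_complex = real_normed_field + euclidean_space +
  fixes conjugate :: "'a \<Rightarrow> 'a"
  assumes conjugate_add: "conjugate (a + b) = conjugate a + conjugate b"
    and conjugate_mult: "conjugate (a * b) = conjugate a * conjugate b"
    and conjugate_conjugate: "conjugate (conjugate a) = a"
    and mult_conjugate: "a * conjugate a = ((norm a)\<^sup>2) *\<^sub>R 1"

instantiation real :: real_or_complex
begin
definition "conjugate (a :: real) = a"
instance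
  by standard (simp_all add: conjugate_real_def power2_eq_square)
end

instantiation complex :: real_or_complex
begin
definition "conjugate (a :: complex) = cnj a"
instance
  by standard (simp_all add: conjugate_complex_def complex_norm_square[symmetric] scaleR_conv_of_real)
end

text \<open>
  Scalar multiplication and the scalar-valued inner product are locale parameters; norm, metric
  and topology come from the type class. Completeness is contained in \<^class>\<open>banach\<close>, and for a
  metric space second countability is the same as separability.
  The inner product is linear in the first argument.
\<close>

locale separable_hilbert_space = vector_space smul
  for smul :: "'k::real_or_complex \<Rightarrow> 'h::{banach, second_countable_topology} \<Rightarrow> 'h" +
  fixes ip :: "'h \<Rightarrow> 'h \<Rightarrow> 'k"
  assumes smul_of_real: "smul (of_real r) x = r *\<^sub>R x"
    and ip_add_left: "ip (x + y) z = ip x z + ip y z"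
    and ip_smul_left: "ip (smul a x) y = a * ip x y"
    and ip_commute: "ip y x = conjugate (ip x y)"
    and ip_self: "ip x x = of_real ((norm x)\<^sup>2)"

lemma separable_hilbert_space_real:
  "separable_hilbert_space (scaleR :: real \<Rightarrow> 'h::{real_inner, banach, second_countable_topology} \<Rightarrow> 'h)
     inner"
  by unfold_locales
    (simp_all add: algebra_simps inner_add_left inner_commute conjugate_real_def power2_norm_eq_inner)

lemma separable_hilbert_space_complex:
  "separable_hilbert_space (*) (\<lambda>x y :: complex. x * cnj y)"
  by unfold_locales
    (simp_all add: algebra_simps conjugate_complex_def complex_norm_square[symmetric] scaleR_conv_of_real)

definition weakly_measurable ::
    "('h \<Rightarrow> 'h \<Rightarrow> 'k::real_or_complex) \<Rightarrow> 'a measure \<Rightarrow> ('a \<Rightarrow> 'h) \<Rightarrow> bool" where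
  "weakly_measurable ip M F \<longleftrightarrow> (\<forall>f. (\<lambda>x. ip f (F x)) \<in> borel_measurable M)"

definition has_weak_integral ::
    "('h \<Rightarrow> 'h \<Rightarrow> 'k::real_or_complex) \<Rightarrow> 'a measure \<Rightarrow> ('a \<Rightarrow> 'h) \<Rightarrow> 'h \<Rightarrow> bool" where
  "has_weak_integral ip M \<Phi> v \<longleftrightarrow>
     (\<forall>g. integrable M (\<lambda>x. ip (\<Phi> x) g) \<and> (\<integral>x. ip (\<Phi> x) g \<partial>M) = ip v g)"

definition weak_integral ::
    "('h \<Rightarrow> 'h \<Rightarrow> 'k::real_or_complex) \<Rightarrow> 'a measure \<Rightarrow> ('a \<Rightarrow> 'h) \<Rightarrow> 'h" where
  "weak_integral ip M \<Phi> = (THE v. has_weak_integral ip M \<Phi> v)"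

definition continuous_frame_with_bounds ::
    "('h::real_normed_vector \<Rightarrow> 'h \<Rightarrow> 'k::real_or_complex) \<Rightarrow> 'a measure \<Rightarrow> ('a \<Rightarrow> 'h) \<Rightarrow> real \<Rightarrow> real \<Rightarrow> bool"
  where
  "continuous_frame_with_bounds ip M F A B \<longleftrightarrow>
     weakly_measurable ip M F \<and> 0 < A \<and> A \<le> B \<and>
     (\<forall>f. ennreal (A * (norm f)\<^sup>2) \<le> (\<integral>\<^sup>+x. ennreal ((norm (ip f (F x)))\<^sup>2) \<partial>M) \<and>
          (\<integral>\<^sup>+x. ennreal ((norm (ip f (F x)))\<^sup>2) \<partial>M) \<le> ennreal (B * (norm f)\<^sup>2))"

definition continuous_frame ::
    "('h::real_normed_vector \<Rightarrow> 'h \<Rightarrow> 'k::real_or_complex) \<Rightarrow> 'a measure \<Rightarrow> ('a \<Rightarrow> 'h) \<Rightarrow> bool" where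
  "continuous_frame ip M F \<longleftrightarrow> (\<exists>A B. continuous_frame_with_bounds ip M F A B)"

definition frame_operator ::
    "('k \<Rightarrow> 'h \<Rightarrow> 'h) \<Rightarrow> ('h \<Rightarrow> 'h \<Rightarrow> 'k::real_or_complex) \<Rightarrow> 'a measure \<Rightarrow> ('a \<Rightarrow> 'h) \<Rightarrow> 'h \<Rightarrow> 'h" where
  "frame_operator smul ip M F f = weak_integral ip M (\<lambda>x. smul (ip f (F x)) (F x))"

text \<open>
  Since \<^const>\<open>weak_integral\<close> is arbitrary where no integral exists, the existence of the integral
  of \<open>\<alpha> F\<close> is part of the following definition.
\<close>

definition continuous_riesz_basis ::
    "('k \<Rightarrow> 'h::real_normed_vector \<Rightarrow> 'h) \<Rightarrow> ('h \<Rightarrow> 'h \<Rightarrow> 'k::real_or_complex) \<Rightarrow> 'a measure \<Rightarrow> ('a \<Rightarrow> 'h) \<Rightarrow> bool"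
  where
  "continuous_riesz_basis smul ip M F \<longleftrightarrow>
     weakly_measurable ip M F \<and>
     closure (module.span smul (F ` space M)) = UNIV \<and>
     (\<exists>A B. 0 < A \<and> A \<le> B \<and>
       (\<forall>\<alpha> :: 'a \<Rightarrow> 'k. \<alpha> \<in> borel_measurable M \<longrightarrow> integrable M (\<lambda>x. (norm (\<alpha> x))\<^sup>2) \<longrightarrow>
         (\<exists>v. has_weak_integral ip M (\<lambda>x. smul (\<alpha> x) (F x)) v \<and>
              A * (\<integral>x. (norm (\<alpha> x))\<^sup>2 \<partial>M) \<le> (norm v)\<^sup>2 \<and>
              (norm v)\<^sup>2 \<le> B * (\<integral>x. (norm (\<alpha> x))\<^sup>2 \<partial>M))))"

definition redundant ::
    "('k \<Rightarrow> 'h::real_normed_vector \<Rightarrow> 'h) \<Rightarrow> ('h \<Rightarrow> 'h \<Rightarrow> 'k::real_or_complex) \<Rightarrow> 'a measure \<Rightarrow> ('a \<Rightarrow> 'h) \<Rightarrow> bool"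
  where
  "redundant smul ip M F \<longleftrightarrow> continuous_frame ip M F \<and> \<not> continuous_riesz_basis smul ip M F"

text \<open>\<open>dual_frame smul ip M F G\<close>: the family \<open>G\<close> is a dual frame of \<open>F\<close>.\<close>

definition dual_frame ::
    "('k \<Rightarrow> 'h::real_normed_vector \<Rightarrow> 'h) \<Rightarrow> ('h \<Rightarrow> 'h \<Rightarrow> 'k::real_or_complex) \<Rightarrow> 'a measure \<Rightarrow>
     ('a \<Rightarrow> 'h) \<Rightarrow> ('a \<Rightarrow> 'h) \<Rightarrow> bool" where
  "dual_frame smul ip M F G \<longleftrightarrow>
     continuous_frame ip M G \<and>
     (\<forall>f. has_weak_integral ip M (\<lambda>x. smul (ip f (G x)) (F x)) f)"

text \<open>
  The union of \<open>F\<close> on \<open>K\<close> and \<open>G\<close> on the complement of \<open>K\<close> is the family glued from the two.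
  Its analysis integral is the sum of the two partial ones, by the lemma following the definition.
\<close>

definition continuous_woven ::
    "('h::real_normed_vector \<Rightarrow> 'h \<Rightarrow> 'k::real_or_complex) \<Rightarrow> 'a measure \<Rightarrow> ('a \<Rightarrow> 'h) \<Rightarrow> ('a \<Rightarrow> 'h) \<Rightarrow> bool"
  where
  "continuous_woven ip M F G \<longleftrightarrow>
     (\<exists>A B. 0 < A \<and> A \<le> B \<and>
       (\<forall>K \<in> sets M. continuous_frame_with_bounds ip M (\<lambda>x. if x \<in> K then F x else G x) A B))"

lemma nn_integral_glued_family:
  assumes "weakly_measurable ip M F" "weakly_measurable ip M G" "K \<in> sets M"
  shows "(\<integral>\<^sup>+x. ennreal ((norm (ip f (if x \<in> K then F x else G x)))\<^sup>2) \<partial>M) =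
         (\<integral>\<^sup>+x\<in>K. ennreal ((norm (ip f (F x)))\<^sup>2) \<partial>M) +
         (\<integral>\<^sup>+x\<in>space M - K. ennreal ((norm (ip f (G x)))\<^sup>2) \<partial>M)"
proof -
  have [measurable]: "(\<lambda>x. ip f (F x)) \<in> borel_measurable M" "(\<lambda>x. ip f (G x)) \<in> borel_measurable M"
    "K \<in> sets M"
    using assms by (auto simp: weakly_measurable_def)
  show ?thesis
    by (subst nn_integral_add[symmetric], measurable)
      (auto intro!: nn_integral_cong simp: indicator_def)
qed

end

theory Submission
  imports Defs
begin

text \<open>
  Write \<open>S\<close> for the frame operator, \<open>A \<le> B\<close> for the frame bounds
  and \<open>q\<close> for the norm of \<open>I - S'\<close>, where \<open>S'\<close> is the
  inverse of \<open>S\<close>. The canonical dual frame \<open>S' F\<close> differs from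
  \<open>F\<close> by the family \<open>(I - S') F\<close>, and since \<open>S'\<close> is
  symmetric, the analysis coefficients of that family at \<open>f\<close> are those of
  \<open>F\<close> at \<open>(I - S') f\<close>. Their squared \<open>L2\<close> norm is at most
  \<open>B q\<^sup>2\<close> times the squared norm of \<open>f\<close>, and \<open>B q\<^sup>2
  < A\<close> by hypothesis. Replacing \<open>F\<close> on part of the index space by a family
  whose difference from \<open>F\<close> has Bessel bound below \<open>A\<close> cannot destroy
  the lower frame bound, uniformly in that part: this is
  \<open>continuous_woven_if_difference_small\<close>. Hence \<open>S' F\<close> is woven with
  \<open>F\<close>, and as the inequality is strict, so is every small enough perturbation of
  it.

  Redundancy provides perturbations that keep duality. If the synthesis operator \<open>\<alpha>
  \<mapsto> \<integral> \<alpha> F\<close> were injective on \<open>L2\<close>, then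
  \<open>\<alpha>\<close> and the coefficients of \<open>S' (\<integral> \<alpha> F)\<close>,
  which have the same image, would agree almost everywhere; this bounds \<open>\<alpha>\<close>
  by its image, and \<open>F\<close> would be a Riesz basis. So there is a nonzero
  \<open>h\<close> in the kernel of the synthesis operator
  (\<open>nontrivial_synthesis_kernel\<close>). For a fixed vector \<open>u \<noteq> 0\<close>
  the families \<open>S' F + \<epsilon> h' u\<close>, where \<open>h'\<close> is the conjugate
  of \<open>h\<close>, are dual frames for every small \<open>\<epsilon>\<close>, and different
  \<open>\<epsilon>\<close> give families that are not equal almost everywhere.

  Two facts about Hilbert spaces underlie this. Weak integrals exist by the Riesz representation
  theorem, and \<open>S\<close> is bijective because \<open>S f = g\<close> is solved by the
  iteration \<open>f \<mapsto> f - (S f - g) / B\<close>, a contraction with constant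
  \<open>sqrt (1 - A / B)\<close>.
\<close>

section \<open>The scalar field\<close>

lemma conjugate_zero [simp]: "conjugate (0 :: 'k::real_or_complex) = 0"
  using conjugate_add[of "0::'k" 0] by simp

lemma conjugate_one [simp]: "conjugate (1 :: 'k::real_or_complex) = 1"
  using conjugate_mult[of "conjugate (1::'k)" 1] by (simp add: conjugate_conjugate)

lemma conjugate_of_real [simp]: "conjugate (of_real r :: 'k::real_or_complex) = of_real r"
proof (cases "r = 0")
  case False
  have "of_real r * conjugate (of_real r :: 'k) = of_real r * of_real r"
    by (simp add: mult_conjugate power2_eq_square flip: scaleR_conv_of_real)
       (simp add: scaleR_conv_of_real)
  then show ?thesis
    using False by simp
qed simp

lemma norm_conjugate [simp]: "norm (conjugate (a :: 'k::real_or_complex)) = norm a"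
proof (cases "a = 0")
  case False
  have "norm (a * conjugate a) = (norm a)\<^sup>2"
    by (simp add: mult_conjugate)
  then have "norm a * norm (conjugate a) = norm a * norm a"
    by (simp add: norm_mult power2_eq_square)
  then show ?thesis
    using False by simp
qed simp

lemma bounded_linear_conjugate: "bounded_linear (conjugate :: 'k::real_or_complex \<Rightarrow> 'k)"
  by (rule bounded_linear_intro[where K = 1])
    (simp_all add: conjugate_add conjugate_mult scaleR_conv_of_real)

lemma one_inner_one [simp]: "(1 :: 'k::real_or_complex) \<bullet> 1 = 1"
  by (simp add: dot_square_norm)

text \<open>
  In the scalar field, the inner product with \<open>1\<close> is the real part. The formula comes from
  expanding \<open>(a + 1) * conjugate (a + 1)\<close>, which is the squared norm of \<open>a + 1\<close>.
\<close>

lemma add_conjugate: "(a :: 'k::real_or_complex) + conjugate a = of_real (2 * (a \<bullet> 1))"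
proof -
  have "(norm (a + 1))\<^sup>2 = (norm a)\<^sup>2 + 2 * (a \<bullet> 1) + 1"
    by (simp add: power2_norm_eq_inner inner_add_left inner_add_right inner_commute)
  moreover have "of_real ((norm (a + 1))\<^sup>2) = of_real ((norm a)\<^sup>2) + (a + conjugate a) + (1::'k)"
    using mult_conjugate[of "a + 1"] mult_conjugate[of a]
    by (simp add: conjugate_add algebra_simps scaleR_conv_of_real)
  ultimately show ?thesis
    by (simp add: algebra_simps)
qed

lemma real_part_of_real [simp]: "(of_real r :: 'k::real_or_complex) \<bullet> 1 = r"
  by (simp add: of_real_def)

lemma real_part_le_norm: "(a :: 'k::real_or_complex) \<bullet> 1 \<le> norm a"
  using norm_cauchy_schwarz[of a 1] by simp

lemma borel_measurable_conjugate [measurable]: "(conjugate :: 'k::real_or_complex \<Rightarrow> 'k) \<in> borel_measurable borel"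
  by (intro borel_measurable_continuous_onI linear_continuous_on bounded_linear_conjugate)

section \<open>Square-integrable scalar functions\<close>

definition square_integrable :: "'a measure \<Rightarrow> ('a \<Rightarrow> 'k::real_or_complex) \<Rightarrow> bool" where
  "square_integrable M \<alpha> \<longleftrightarrow> \<alpha> \<in> borel_measurable M \<and> integrable M (\<lambda>x. (norm (\<alpha> x))\<^sup>2)"

text \<open>
  The Cauchy-Schwarz inequality in \<open>L2\<close>. The product is integrable because it is dominated by the sum
  of the squares; the bound is the inequality for nonnegative integrals.
\<close>

lemma square_integrable_mult:
  fixes \<alpha> \<beta> :: "'a \<Rightarrow> 'k::real_or_complex"
  assumes sq: "square_integrable M \<alpha>" "square_integrable M \<beta>"
  shows "integrable M (\<lambda>x. \<alpha> x * \<beta> x)"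
    and "(norm (\<integral>x. \<alpha> x * \<beta> x \<partial>M))\<^sup>2 \<le>
           (\<integral>x. (norm (\<alpha> x))\<^sup>2 \<partial>M) * (\<integral>x. (norm (\<beta> x))\<^sup>2 \<partial>M)"
proof -
  have [measurable]: "\<alpha> \<in> borel_measurable M" "\<beta> \<in> borel_measurable M"
    and \<alpha>: "integrable M (\<lambda>x. (norm (\<alpha> x))\<^sup>2)" and \<beta>: "integrable M (\<lambda>x. (norm (\<beta> x))\<^sup>2)"
    using sq by (auto simp: square_integrable_def)
  have amgm: "norm a * norm b \<le> (norm a)\<^sup>2 + (norm b)\<^sup>2" for a b :: 'k
  proof -
    have "0 \<le> norm a * norm b" by simp
    then show ?thesis
      using sum_squares_bound[of "norm a" "norm b"] by linarith
  qed
  show int: "integrable M (\<lambda>x. \<alpha> x * \<beta> x)"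
    by (rule Bochner_Integration.integrable_bound[OF Bochner_Integration.integrable_add[OF \<alpha> \<beta>]])
      (use amgm in \<open>auto simp: norm_mult\<close>)
  let ?c = "\<integral>x. norm (\<alpha> x * \<beta> x) \<partial>M"
  let ?a = "\<integral>x. (norm (\<alpha> x))\<^sup>2 \<partial>M" and ?b = "\<integral>x. (norm (\<beta> x))\<^sup>2 \<partial>M"
  have "(\<integral>\<^sup>+x. ennreal (norm (\<alpha> x)) * ennreal (norm (\<beta> x)) \<partial>M)\<^sup>2 \<le>
      (\<integral>\<^sup>+x. (ennreal (norm (\<alpha> x)))\<^sup>2 \<partial>M) * (\<integral>\<^sup>+x. (ennreal (norm (\<beta> x)))\<^sup>2 \<partial>M)"
    by (rule Cauchy_Schwarz_nn_integral) measurable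
  also have "(\<integral>\<^sup>+x. ennreal (norm (\<alpha> x)) * ennreal (norm (\<beta> x)) \<partial>M) = ennreal ?c"
    using nn_integral_eq_integral[OF integrable_norm[OF int]] by (simp add: norm_mult ennreal_mult)
  also have "(\<integral>\<^sup>+x. (ennreal (norm (\<alpha> x)))\<^sup>2 \<partial>M) = ennreal ?a"
    using nn_integral_eq_integral[OF \<alpha>] by (simp add: ennreal_power)
  also have "(\<integral>\<^sup>+x. (ennreal (norm (\<beta> x)))\<^sup>2 \<partial>M) = ennreal ?b"
    using nn_integral_eq_integral[OF \<beta>] by (simp add: ennreal_power)
  finally have "ennreal (?c\<^sup>2) \<le> ennreal (?a * ?b)"
    by (simp add: ennreal_power ennreal_mult)
  then have "?c\<^sup>2 \<le> ?a * ?b"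
    by (subst (asm) ennreal_le_iff) auto
  moreover have "(norm (\<integral>x. \<alpha> x * \<beta> x \<partial>M))\<^sup>2 \<le> ?c\<^sup>2"
    by (intro power_mono integral_norm_bound) auto
  ultimately show "(norm (\<integral>x. \<alpha> x * \<beta> x \<partial>M))\<^sup>2 \<le> ?a * ?b"
    by linarith
qed


text \<open>
  A substitute for Minkowski's inequality that deals with squares only: optimising over the weight
  \<open>t\<close> recovers the triangle inequality in \<open>L2\<close>, and a fixed \<open>t\<close> can be integrated termwise.
\<close>

lemma norm_add_sq_weighted:
  fixes a b :: "'b::real_normed_vector"
  assumes "0 < t"
  shows "(norm (a + b))\<^sup>2 \<le> (1 + t) * (norm a)\<^sup>2 + (1 + 1 / t) * (norm b)\<^sup>2"
proof -
  have "0 \<le> (t * norm a - norm b)\<^sup>2 / t"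
    using assms by simp
  also have "\<dots> = t * (norm a)\<^sup>2 + (norm b)\<^sup>2 / t - 2 * norm a * norm b"
    using assms by (simp add: field_simps power2_eq_square)
  finally have "2 * norm a * norm b \<le> t * (norm a)\<^sup>2 + (norm b)\<^sup>2 / t"
    by simp
  moreover have "(norm (a + b))\<^sup>2 \<le> (norm a + norm b)\<^sup>2"
    by (intro power_mono norm_triangle_ineq) simp
  ultimately show ?thesis
    by (simp add: power2_sum algebra_simps)
qed

lemma square_integrable_add:
  assumes "square_integrable M \<alpha>" "square_integrable M \<beta>"
  shows "square_integrable M (\<lambda>x. \<alpha> x + \<beta> x)"
proof -
  have [measurable]: "\<alpha> \<in> borel_measurable M" "\<beta> \<in> borel_measurable M"
    and int: "integrable M (\<lambda>x. (norm (\<alpha> x))\<^sup>2)" "integrable M (\<lambda>x. (norm (\<beta> x))\<^sup>2)"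
    using assms by (auto simp: square_integrable_def)
  have "integrable M (\<lambda>x. (1 + 1) * (norm (\<alpha> x))\<^sup>2 + (1 + 1 / 1) * (norm (\<beta> x))\<^sup>2)"
    using int by auto
  then have "integrable M (\<lambda>x. (norm (\<alpha> x + \<beta> x))\<^sup>2)"
  proof (rule Bochner_Integration.integrable_bound)
    show "AE x in M. norm ((norm (\<alpha> x + \<beta> x))\<^sup>2) \<le>
        norm ((1 + 1) * (norm (\<alpha> x))\<^sup>2 + (1 + 1 / 1) * (norm (\<beta> x))\<^sup>2)"
      unfolding real_norm_def abs_power2
      by (intro AE_I2 order_trans[OF norm_add_sq_weighted abs_ge_self]) simp
  qed measurable
  then show ?thesis
    by (simp add: square_integrable_def)
qed

lemma square_integrable_diff:
  assumes "square_integrable M \<alpha>" "square_integrable M \<beta>"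
  shows "square_integrable M (\<lambda>x. \<alpha> x - \<beta> x)"
  using square_integrable_add[of M \<alpha> "\<lambda>x. - \<beta> x"] assms by (simp add: square_integrable_def)

section \<open>Hilbert space geometry\<close>

context separable_hilbert_space
begin

lemma ip_add_right: "ip x (y + z) = ip x y + ip x z"
  by (metis ip_commute ip_add_left conjugate_add)

lemma ip_smul_right: "ip x (smul a y) = conjugate a * ip x y"
  by (metis ip_commute ip_smul_left conjugate_mult)

lemma ip_scaleR_left: "ip (r *\<^sub>R x) y = of_real r * ip x y"
  by (metis smul_of_real ip_smul_left)

lemma ip_scaleR_right: "ip x (r *\<^sub>R y) = of_real r * ip x y"
  by (metis smul_of_real ip_smul_right conjugate_of_real)

lemma ip_minus_left: "ip (- x) y = - ip x y"
  using ip_scaleR_left[of "-1" x y] by simp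

lemma ip_minus_right: "ip x (- y) = - ip x y"
  using ip_scaleR_right[of x "-1" y] by simp

lemma ip_diff_left: "ip (x - y) z = ip x z - ip y z"
  using ip_add_left[of x "- y" z] by (simp add: ip_minus_left)

lemma ip_diff_right: "ip x (y - z) = ip x y - ip x z"
  using ip_add_right[of x y "- z"] by (simp add: ip_minus_right)

lemma ip_zero_left [simp]: "ip 0 y = 0"
  using ip_diff_left[of 0 0 y] by simp

lemma ip_zero_right [simp]: "ip x 0 = 0"
  using ip_diff_right[of x 0 0] by simp

lemma eq_if_ip_eq: "(\<And>g. ip x g = ip y g) \<Longrightarrow> x = y"
  using ip_self[of "x - y"] by (simp add: ip_diff_left)

lemma norm_add_sq: "(norm (x + y))\<^sup>2 = (norm x)\<^sup>2 + 2 * (ip x y \<bullet> 1) + (norm y)\<^sup>2"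
proof -
  have "of_real ((norm (x + y))\<^sup>2) = ip x x + (ip x y + conjugate (ip x y)) + ip y y"
    by (simp add: ip_self[symmetric] ip_add_left ip_add_right ip_commute[of y x] algebra_simps
        del: of_real_power)
  also have "\<dots> = of_real ((norm x)\<^sup>2 + 2 * (ip x y \<bullet> 1) + (norm y)\<^sup>2)"
    by (simp add: add_conjugate ip_self)
  finally show ?thesis
    by (simp only: of_real_eq_iff)
qed

lemma norm_diff_sq: "(norm (x - y))\<^sup>2 = (norm x)\<^sup>2 - 2 * (ip x y \<bullet> 1) + (norm y)\<^sup>2"
  using norm_add_sq[of x "- y"] by (simp add: ip_minus_right)

lemma norm_smul: "norm (smul a x) = norm a * norm x"
proof -
  have "of_real ((norm (smul a x))\<^sup>2) = (a * conjugate a) * ip x x"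
    by (simp add: ip_self[symmetric] ip_smul_left ip_smul_right del: of_real_power)
  also have "\<dots> = of_real ((norm a * norm x)\<^sup>2)"
    by (simp add: mult_conjugate ip_self scaleR_conv_of_real power_mult_distrib)
  finally have "(norm (smul a x))\<^sup>2 = (norm a * norm x)\<^sup>2"
    by (simp only: of_real_eq_iff)
  then show ?thesis
    by (simp add: power2_eq_iff_nonneg)
qed

text \<open>
  With \<open>c = ip x y\<close>, the vector \<open>(norm y)\<^sup>2 x - c y\<close> is a multiple of the component of \<open>x\<close> orthogonal to
  \<open>y\<close>; its squared norm is \<open>(norm y)\<^sup>2\<close> times the difference of the two squared sides.
\<close>

lemma ip_Cauchy_Schwarz: "norm (ip x y) \<le> norm x * norm y"
proof (cases "y = 0")
  case False
  define c where "c = ip x y"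
  have "ip x (smul c y) = of_real ((norm c)\<^sup>2)"
    using mult_conjugate[of c] by (simp add: ip_smul_right c_def mult.commute scaleR_conv_of_real)
  then have "(norm ((norm y)\<^sup>2 *\<^sub>R x - smul c y))\<^sup>2 =
      ((norm y)\<^sup>2)\<^sup>2 * (norm x)\<^sup>2 - 2 * ((norm y)\<^sup>2 * (norm c)\<^sup>2) + (norm c)\<^sup>2 * (norm y)\<^sup>2"
    by (simp add: norm_diff_sq norm_smul ip_scaleR_left power_mult_distrib
        flip: of_real_power of_real_mult)
  also have "\<dots> = (norm y)\<^sup>2 * ((norm x * norm y)\<^sup>2 - (norm c)\<^sup>2)"
    by (simp add: power2_eq_square algebra_simps)
  finally have "0 \<le> (norm y)\<^sup>2 * ((norm x * norm y)\<^sup>2 - (norm c)\<^sup>2)"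
    by (metis zero_le_power2)
  then have "(norm c)\<^sup>2 \<le> (norm x * norm y)\<^sup>2"
    using False by (simp add: zero_le_mult_iff)
  then show ?thesis
    unfolding c_def by (rule power2_le_imp_le) simp
qed simp

lemma bounded_linear_ip_left: "bounded_linear (\<lambda>x. ip x y)"
  by (rule bounded_linear_intro[where K = "norm y"])
    (simp_all add: ip_add_left ip_scaleR_left scaleR_conv_of_real ip_Cauchy_Schwarz)

text \<open>
  The representing vector minimises \<open>J v = (norm v)\<^sup>2 - 2 Re (\<phi> v)\<close> over \<open>V\<close>: by the parallelogram
  identity a minimising sequence is Cauchy, and stationarity of \<open>J\<close> at its limit says that the real
  parts of \<open>ip v g\<close> and \<open>\<phi> g\<close> agree. As \<open>V\<close> may fail to be closed, the limit lies in the closure only.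
  The case \<open>V = UNIV\<close> yields weak integrals; the case of a span yields orthogonal projections onto
  its closure.
\<close>

lemma Riesz_representation_on_subspace:
  assumes V: "subspace V"
    and add: "\<And>x y. x \<in> V \<Longrightarrow> y \<in> V \<Longrightarrow> \<phi> (x + y) = \<phi> x + \<phi> y"
    and smul: "\<And>c x. x \<in> V \<Longrightarrow> \<phi> (smul c x) = conjugate c * \<phi> x"
    and bound: "\<And>x. x \<in> V \<Longrightarrow> norm (\<phi> x) \<le> C * norm x"
  obtains v where "v \<in> closure V" "\<And>g. g \<in> V \<Longrightarrow> \<phi> g = ip v g"
proof -
  have V0: "0 \<in> V" and Vadd: "\<And>x y. x \<in> V \<Longrightarrow> y \<in> V \<Longrightarrow> x + y \<in> V"
    and Vsmul: "\<And>c x. x \<in> V \<Longrightarrow> smul c x \<in> V"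
    using V by (auto simp: subspace_def)
  have VscaleR: "r *\<^sub>R x \<in> V" if "x \<in> V" for r x
    using Vsmul[OF that, of "of_real r"] by (simp add: smul_of_real)
  have scaleR: "\<phi> (r *\<^sub>R x) = of_real r * \<phi> x" if "x \<in> V" for r x
    using smul[OF that, of "of_real r"] by (simp add: smul_of_real)
  define J where "J v = (norm v)\<^sup>2 - 2 * (\<phi> v \<bullet> 1)" for v
  define m where "m = Inf (J ` V)"
  have J_bdd: "- C\<^sup>2 \<le> J v" if "v \<in> V" for v
  proof -
    have "\<phi> v \<bullet> 1 \<le> C * norm v"
      using real_part_le_norm[of "\<phi> v"] bound[OF that] by linarith
    moreover have "0 \<le> (norm v - C)\<^sup>2" by simp
    ultimately show ?thesis
      by (simp add: J_def power2_eq_square algebra_simps)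
  qed
  have m_le: "m \<le> J v" if "v \<in> V" for v
    unfolding m_def by (rule cInf_lower) (use that J_bdd in \<open>auto simp: bdd_below_def\<close>)
  have "\<exists>v\<in>V. J v < m + inverse (real (Suc n))" for n
    using cInf_lessD[of "J ` V" "m + inverse (real (Suc n))"] V0 by (auto simp: m_def)
  then obtain w where w: "\<And>n. w n \<in> V" "\<And>n. J (w n) < m + inverse (real (Suc n))"
    by metis
  have parallelogram: "(norm (a - b))\<^sup>2 \<le> 2 * (J a - m) + 2 * (J b - m)" if "a \<in> V" "b \<in> V" for a b
  proof -
    have "m \<le> J ((1/2) *\<^sub>R (a + b))"
      by (intro m_le VscaleR Vadd that)
    also have "\<dots> = (norm (a + b))\<^sup>2 / 4 - (\<phi> a \<bullet> 1 + \<phi> b \<bullet> 1)"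
    proof -
      have "\<phi> ((1/2) *\<^sub>R (a + b)) = (1/2) *\<^sub>R (\<phi> a + \<phi> b)"
        using scaleR[OF Vadd[OF that], of "1/2"] add[OF that] by (simp add: scaleR_conv_of_real)
      then show ?thesis
        by (simp add: J_def power_divide inner_add_left) argo
    qed
    finally have "4 * m \<le> (norm (a + b))\<^sup>2 - 4 * (\<phi> a \<bullet> 1 + \<phi> b \<bullet> 1)"
      by simp
    then show ?thesis
      unfolding J_def norm_add_sq norm_diff_sq by simp
  qed
  have "Cauchy w"
  proof (rule metric_CauchyI)
    fix e :: real
    assume e: "0 < e"
    obtain N where "inverse (real (Suc N)) < e\<^sup>2 / 4"
      using reals_Archimedean[of "e\<^sup>2 / 4"] e by auto
    then have N: "4 * inverse (real (Suc N)) < e\<^sup>2"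
      by simp
    have J_close: "4 * (J (w n) - m) < e\<^sup>2" if "n \<ge> N" for n
    proof -
      have "inverse (real (Suc n)) \<le> inverse (real (Suc N))"
        using that by (intro le_imp_inverse_le) auto
      then have "J (w n) - m < inverse (real (Suc N))"
        using w(2)[of n] by linarith
      then have "4 * (J (w n) - m) < 4 * inverse (real (Suc N))"
        by (rule mult_strict_left_mono) simp
      also note N
      finally show ?thesis .
    qed
    have "dist (w n) (w k) < e" if "n \<ge> N" "k \<ge> N" for n k
    proof -
      have "(norm (w n - w k))\<^sup>2 < e\<^sup>2"
        using parallelogram[OF w(1)[of n] w(1)[of k]] J_close[OF that(1)] J_close[OF that(2)] by linarith
      then show ?thesis
        using e by (simp add: dist_norm power_less_imp_less_base)
    qed
    then show "\<exists>N. \<forall>n\<ge>N. \<forall>k\<ge>N. dist (w n) (w k) < e"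
      by blast
  qed
  then obtain v where v: "w \<longlonglongrightarrow> v"
    using Cauchy_convergent_iff convergent_def by blast
  have J_lim: "(\<lambda>n. J (w n)) \<longlonglongrightarrow> m"
  proof (rule tendsto_sandwich[of "\<lambda>_. m" _ _ "\<lambda>n. m + inverse (real (Suc n))"])
    show "(\<lambda>n. m + inverse (real (Suc n))) \<longlonglongrightarrow> m"
      using tendsto_add[OF tendsto_const LIMSEQ_inverse_real_of_nat, of m] by simp
    show "\<forall>\<^sub>F n in sequentially. J (w n) \<le> m + inverse (real (Suc n))"
      using w(2) by (auto intro!: always_eventually less_imp_le)
  qed (use m_le w(1) in \<open>auto intro!: always_eventually\<close>)
  have real_part_eq: "ip v g \<bullet> 1 = \<phi> g \<bullet> 1" if g: "g \<in> V" for g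
  proof -
    define a where "a = ip v g \<bullet> 1 - \<phi> g \<bullet> 1"
    define b where "b = (norm g)\<^sup>2"
    have quadratic: "0 \<le> 2 * t * a + t\<^sup>2 * b" for t
    proof -
      have J_shift: "J (w n + t *\<^sub>R g) = J (w n) + 2 * t * (ip (w n) g \<bullet> 1 - \<phi> g \<bullet> 1) + t\<^sup>2 * b" for n
      proof -
        have "\<phi> (w n + t *\<^sub>R g) = \<phi> (w n) + t *\<^sub>R \<phi> g"
          using add[OF w(1) VscaleR[OF g]] scaleR[OF g] by (simp add: scaleR_conv_of_real)
        moreover have "ip (w n) (t *\<^sub>R g) = t *\<^sub>R ip (w n) g"
          by (simp add: ip_scaleR_right scaleR_conv_of_real)
        ultimately show ?thesis
          by (simp add: J_def norm_add_sq inner_add_left b_def power_mult_distrib algebra_simps)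
      qed
      have "(\<lambda>n. J (w n + t *\<^sub>R g)) \<longlonglongrightarrow> m + 2 * t * a + t\<^sup>2 * b"
        unfolding J_shift a_def
        by (intro tendsto_intros J_lim bounded_linear.tendsto[OF bounded_linear_ip_left] v)
      then have "m \<le> m + 2 * t * a + t\<^sup>2 * b"
        by (rule LIMSEQ_le_const) (use m_le w(1) Vadd VscaleR g in blast)
      then show ?thesis
        by simp
    qed
    have b: "b \<ge> 0"
      by (simp add: b_def)
    \<comment> \<open>This \<open>t\<close> makes the quadratic minus a positive multiple of \<open>a\<^sup>2\<close>, also when \<open>b = 0\<close>.\<close>
    have "0 \<le> (2 * (- a / (b + 1)) * a + (- a / (b + 1))\<^sup>2 * b) * (b + 1)\<^sup>2"
      by (intro mult_nonneg_nonneg quadratic) simp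
    also have "\<dots> = - (a\<^sup>2 * (b + 2))"
      using b by (simp add: divide_simps) (simp add: power2_eq_square algebra_simps)
    finally have "a = 0"
      using b by (simp add: mult_le_0_iff)
    then show ?thesis
      by (simp add: a_def)
  qed
  have "\<phi> g = ip v g" if g: "g \<in> V" for g
  proof -
    \<comment> \<open>Testing with \<open>smul c g\<close> turns the equality of real parts into \<open>(norm c)\<^sup>2 = 0\<close>.\<close>
    define c where "c = \<phi> g - ip v g"
    have "(conjugate c * c) \<bullet> 1 = 0"
      using real_part_eq[OF Vsmul[OF g, of c]]
      by (simp add: smul[OF g] ip_smul_right c_def right_diff_distrib inner_diff_left)
    then have "(norm c)\<^sup>2 = 0"
      using mult_conjugate[of c] real_part_of_real[of "(norm c)\<^sup>2", where 'k='k]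
      by (simp add: mult.commute of_real_def)
    then show ?thesis
      by (simp add: c_def)
  qed
  moreover have "v \<in> closure V"
    using v w(1) closure_sequential by blast
  ultimately show thesis
    using that by blast
qed

section \<open>Bessel families and weaving\<close>

definition Bessel_with_bound :: "'a measure \<Rightarrow> ('a \<Rightarrow> 'h) \<Rightarrow> real \<Rightarrow> bool" where
  "Bessel_with_bound M D d \<longleftrightarrow>
     (\<forall>f. square_integrable M (\<lambda>x. ip f (D x)) \<and>
          (\<integral>x. (norm (ip f (D x)))\<^sup>2 \<partial>M) \<le> d * (norm f)\<^sup>2)"

lemma Bessel_weakly_measurable: "Bessel_with_bound M D d \<Longrightarrow> weakly_measurable ip M D"
  by (simp add: Bessel_with_bound_def square_integrable_def weakly_measurable_def)

text \<open>
  From here on the frame inequalities are used with real-valued integrals; integrability of the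
  squared coefficients is what the finite upper bound in the extended inequality amounts to.
\<close>

lemma continuous_frame_with_bounds_iff:
  "continuous_frame_with_bounds ip M F A B \<longleftrightarrow>
     0 < A \<and> A \<le> B \<and> Bessel_with_bound M F B \<and>
     (\<forall>f. A * (norm f)\<^sup>2 \<le> (\<integral>x. (norm (ip f (F x)))\<^sup>2 \<partial>M))"
proof -
  have "ennreal (A * (norm f)\<^sup>2) \<le> (\<integral>\<^sup>+x. ennreal ((norm (ip f (F x)))\<^sup>2) \<partial>M) \<and>
      (\<integral>\<^sup>+x. ennreal ((norm (ip f (F x)))\<^sup>2) \<partial>M) \<le> ennreal (B * (norm f)\<^sup>2) \<longleftrightarrow>
      integrable M (\<lambda>x. (norm (ip f (F x)))\<^sup>2) \<and>
      (\<integral>x. (norm (ip f (F x)))\<^sup>2 \<partial>M) \<le> B * (norm f)\<^sup>2 \<and>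
      A * (norm f)\<^sup>2 \<le> (\<integral>x. (norm (ip f (F x)))\<^sup>2 \<partial>M)" (is "?L \<longleftrightarrow> ?R")
    if F: "weakly_measurable ip M F" and AB: "0 < A" "A \<le> B" for f
  proof -
    have [measurable]: "(\<lambda>x. ip f (F x)) \<in> borel_measurable M"
      using F by (simp add: weakly_measurable_def)
    have meas: "(\<lambda>x. (norm (ip f (F x)))\<^sup>2) \<in> borel_measurable M"
      by measurable
    have pos: "0 \<le> A * (norm f)\<^sup>2" "0 \<le> B * (norm f)\<^sup>2"
      using AB by auto
    have int_pos: "0 \<le> (\<integral>x. (norm (ip f (F x)))\<^sup>2 \<partial>M)"
      by simp
    show ?thesis
    proof
      assume L: ?L
      then have int: "integrable M (\<lambda>x. (norm (ip f (F x)))\<^sup>2)"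
        using meas by (intro integrableI_bounded) (auto intro: le_less_trans)
      then show ?R
        using L nn_integral_eq_integral[OF int] pos int_pos by (simp add: ennreal_le_iff)
    next
      assume R: ?R
      then show ?L
        using nn_integral_eq_integral[of M "\<lambda>x. (norm (ip f (F x)))\<^sup>2"] by (simp add: ennreal_leI)
    qed
  qed
  then show ?thesis
    unfolding continuous_frame_with_bounds_def Bessel_with_bound_def square_integrable_def
      weakly_measurable_def by blast
qed

lemma Bessel_add:
  assumes C: "Bessel_with_bound M C c" and D: "Bessel_with_bound M D d" and "0 < t"
  shows "Bessel_with_bound M (\<lambda>x. C x + D x) ((1 + t) * c + (1 + 1 / t) * d)"
  unfolding Bessel_with_bound_def
proof (intro allI conjI)
  fix f
  have sq: "square_integrable M (\<lambda>x. ip f (C x))" "square_integrable M (\<lambda>x. ip f (D x))"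
    and le: "(\<integral>x. (norm (ip f (C x)))\<^sup>2 \<partial>M) \<le> c * (norm f)\<^sup>2"
      "(\<integral>x. (norm (ip f (D x)))\<^sup>2 \<partial>M) \<le> d * (norm f)\<^sup>2"
    using C D by (auto simp: Bessel_with_bound_def)
  have int: "integrable M (\<lambda>x. (norm (ip f (C x)))\<^sup>2)" "integrable M (\<lambda>x. (norm (ip f (D x)))\<^sup>2)"
    using sq by (auto simp: square_integrable_def)
  let ?w = "\<lambda>x. (1 + t) * (norm (ip f (C x)))\<^sup>2 + (1 + 1 / t) * (norm (ip f (D x)))\<^sup>2"
  have w: "integrable M ?w"
    using int by auto
  have pointwise: "(norm (ip f (C x + D x)))\<^sup>2 \<le> ?w x" for x
    unfolding ip_add_right by (rule norm_add_sq_weighted[OF \<open>0 < t\<close>])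
  show sq_sum: "square_integrable M (\<lambda>x. ip f (C x + D x))"
    unfolding ip_add_right by (rule square_integrable_add[OF sq])
  then have int_sum: "integrable M (\<lambda>x. (norm (ip f (C x + D x)))\<^sup>2)"
    by (simp add: square_integrable_def)
  have "(\<integral>x. (norm (ip f (C x + D x)))\<^sup>2 \<partial>M) \<le> (\<integral>x. ?w x \<partial>M)"
    by (intro integral_mono int_sum w pointwise)
  also have "\<dots> = (1 + t) * (\<integral>x. (norm (ip f (C x)))\<^sup>2 \<partial>M) + (1 + 1 / t) * (\<integral>x. (norm (ip f (D x)))\<^sup>2 \<partial>M)"
    using int by simp
  also have "\<dots> \<le> (1 + t) * (c * (norm f)\<^sup>2) + (1 + 1 / t) * (d * (norm f)\<^sup>2)"
    using \<open>0 < t\<close> le by (intro add_mono mult_left_mono) auto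
  also have "\<dots> = ((1 + t) * c + (1 + 1 / t) * d) * (norm f)\<^sup>2"
    by (simp add: algebra_simps)
  finally show "(\<integral>x. (norm (ip f (C x + D x)))\<^sup>2 \<partial>M) \<le> ((1 + t) * c + (1 + 1 / t) * d) * (norm f)\<^sup>2" .
qed

text \<open>
  The glued family is \<open>F + E\<close>, where \<open>E\<close> is \<open>G - F\<close> off \<open>K\<close> and zero on \<open>K\<close>. So \<open>E\<close> has Bessel bound \<open>d\<close>
  for every \<open>K\<close>, and the coefficients of the glued family are those of \<open>F\<close> up to an error of squared
  norm at most \<open>d\<close> times that of the vector, which is too small to cancel the lower bound \<open>A\<close>. All constants are independent
  of \<open>K\<close>.
\<close>

lemma continuous_woven_if_difference_small:
  assumes F: "continuous_frame_with_bounds ip M F A B"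
    and D: "Bessel_with_bound M (\<lambda>x. G x - F x) d" and d: "0 \<le> d" "d < A"
  shows "continuous_woven ip M F G"
proof -
  have A: "0 < A" and AB: "A \<le> B" and FB: "Bessel_with_bound M F B"
    and lower: "\<And>f. A * (norm f)\<^sup>2 \<le> (\<integral>x. (norm (ip f (F x)))\<^sup>2 \<partial>M)"
    using F by (auto simp: continuous_frame_with_bounds_iff)
  \<comment> \<open>This weight makes \<open>d / t\<close> at most \<open>(A - d) / 2\<close>, as \<open>d \<le> B\<close>.\<close>
  define t where "t = 2 * B / (A - d)"
  have t: "0 < t"
    using A AB d by (simp add: t_def)
  have "(1 + 1 / t) * d < A"
  proof -
    have "t * (2 * (d / t)) = 2 * d"
      using t by simp
    also have "\<dots> \<le> 2 * B"
      using AB d by simp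
    also have "\<dots> = t * (A - d)"
      using d by (simp add: t_def)
    finally have "2 * (d / t) \<le> A - d"
      using t by (rule mult_left_le_imp_le)
    then have "d + d / t < A"
      using d by linarith
    then show ?thesis
      by (simp add: distrib_right)
  qed
  define A' where "A' = (A - (1 + 1 / t) * d) / (1 + t)"
  define B' where "B' = (1 + 1) * B + (1 + 1 / 1) * d"
  have A': "0 < A'"
    using \<open>(1 + 1 / t) * d < A\<close> t by (simp add: A'_def)
  have "A' \<le> A / 1"
    unfolding A'_def using A d t by (intro frac_le) auto
  then have AB': "A' \<le> B'"
    using A AB d by (simp add: B'_def)
  have "continuous_frame_with_bounds ip M (\<lambda>x. if x \<in> K then F x else G x) A' B'"
    if K: "K \<in> sets M" for K
  proof -
    let ?W = "\<lambda>x. if x \<in> K then F x else G x"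
    define E where "E x = (if x \<in> K then 0 else G x - F x)" for x
    have [measurable]: "K \<in> sets M"
      by (fact K)
    have meas_D: "(\<lambda>x. ip f (G x - F x)) \<in> borel_measurable M"
      and int_D: "integrable M (\<lambda>x. (norm (ip f (G x - F x)))\<^sup>2)"
      and le_D: "(\<integral>x. (norm (ip f (G x - F x)))\<^sup>2 \<partial>M) \<le> d * (norm f)\<^sup>2" for f
      using D by (auto simp: Bessel_with_bound_def square_integrable_def)
    have E_eq: "ip f (E x) = (if x \<in> K then 0 else ip f (G x - F x))" for f x
      by (simp add: E_def)
    have meas_E: "(\<lambda>x. ip f (E x)) \<in> borel_measurable M" for f
      unfolding E_eq using meas_D[of f] by measurable
    have int_E: "integrable M (\<lambda>x. (norm (ip f (E x)))\<^sup>2)" for f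
      by (rule Bochner_Integration.integrable_bound[OF int_D[of f]])
        (use meas_E[of f] in \<open>auto simp: E_eq\<close>)
    have le_E: "(\<integral>x. (norm (ip f (E x)))\<^sup>2 \<partial>M) \<le> d * (norm f)\<^sup>2" for f
      by (rule order_trans[OF integral_mono[OF int_E int_D] le_D]) (simp add: E_eq)
    have EB: "Bessel_with_bound M E d"
      using meas_E int_E le_E by (simp add: Bessel_with_bound_def square_integrable_def)
    have W: "?W = (\<lambda>x. F x + E x)"
      by (auto simp: E_def)
    have WB: "Bessel_with_bound M ?W B'"
      unfolding W B'_def by (rule Bessel_add[OF FB EB]) simp
    have "A' * (norm f)\<^sup>2 \<le> (\<integral>x. (norm (ip f (?W x)))\<^sup>2 \<partial>M)" for f
    proof -
      let ?w = "\<integral>x. (norm (ip f (?W x)))\<^sup>2 \<partial>M"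
      have int_W: "integrable M (\<lambda>x. (norm (ip f (?W x)))\<^sup>2)"
        and int_F: "integrable M (\<lambda>x. (norm (ip f (F x)))\<^sup>2)"
        using WB FB by (auto simp: Bessel_with_bound_def square_integrable_def)
      have pointwise: "(norm (ip f (F x)))\<^sup>2 \<le>
          (1 + t) * (norm (ip f (?W x)))\<^sup>2 + (1 + 1 / t) * (norm (ip f (E x)))\<^sup>2" for x
      proof -
        have "ip f (F x) = ip f (?W x) + - ip f (E x)"
          by (simp add: E_def ip_diff_right)
        then show ?thesis
          using norm_add_sq_weighted[OF t, of "ip f (?W x)" "- ip f (E x)"]
          by (simp only: norm_minus_cancel)
      qed
      have "A * (norm f)\<^sup>2 \<le> (\<integral>x. (norm (ip f (F x)))\<^sup>2 \<partial>M)"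
        by (rule lower)
      also have "\<dots> \<le> (\<integral>x. (1 + t) * (norm (ip f (?W x)))\<^sup>2 + (1 + 1 / t) * (norm (ip f (E x)))\<^sup>2 \<partial>M)"
        using pointwise int_W int_F int_E by (intro integral_mono) auto
      also have "\<dots> = (1 + t) * ?w + (1 + 1 / t) * (\<integral>x. (norm (ip f (E x)))\<^sup>2 \<partial>M)"
        using int_W int_E[of f] by simp
      also have "\<dots> \<le> (1 + t) * ?w + (1 + 1 / t) * (d * (norm f)\<^sup>2)"
        using le_E[of f] t by (intro add_left_mono mult_left_mono) auto
      finally show ?thesis
        using t by (simp add: A'_def pos_divide_le_eq algebra_simps)
    qed
    then show ?thesis
      using A' AB' WB by (simp add: continuous_frame_with_bounds_iff)
  qed
  then show ?thesis
    using A' AB' by (auto simp: continuous_woven_def)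
qed

lemma has_weak_integral_unique:
  "has_weak_integral ip M \<Phi> v \<Longrightarrow> has_weak_integral ip M \<Phi> w \<Longrightarrow> v = w"
  by (rule eq_if_ip_eq) (metis has_weak_integral_def)

text \<open>
  The synthesis operator is defined on all of \<open>L2\<close>: by Cauchy-Schwarz the integral against a test
  vector \<open>g\<close> is a bounded conjugate-linear functional of \<open>g\<close>, so it is represented by some \<open>v\<close>.
  Testing with \<open>g = v\<close> gives the norm bound.
\<close>

lemma synthesis_exists:
  assumes F: "Bessel_with_bound M F B" and B: "0 \<le> B" and \<alpha>: "square_integrable M \<alpha>"
  obtains v where "has_weak_integral ip M (\<lambda>x. smul (\<alpha> x) (F x)) v"
    and "(norm v)\<^sup>2 \<le> B * (\<integral>x. (norm (\<alpha> x))\<^sup>2 \<partial>M)"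
proof -
  let ?a = "\<integral>x. (norm (\<alpha> x))\<^sup>2 \<partial>M"
  have norm_ip: "norm (ip (F x) g) = norm (ip g (F x))" for x g
    by (metis ip_commute norm_conjugate)
  have meas: "(\<lambda>x. ip (F x) g) \<in> borel_measurable M" for g
  proof -
    have "(\<lambda>x. ip g (F x)) \<in> borel_measurable M"
      using F by (simp add: Bessel_with_bound_def square_integrable_def)
    then show ?thesis
      unfolding ip_commute[of _ g] by measurable
  qed
  have sq_F: "square_integrable M (\<lambda>x. ip (F x) g)"
    and le_F: "(\<integral>x. (norm (ip (F x) g))\<^sup>2 \<partial>M) \<le> B * (norm g)\<^sup>2" for g
    using F meas[of g] by (auto simp: Bessel_with_bound_def square_integrable_def norm_ip)
  have int: "integrable M (\<lambda>x. \<alpha> x * ip (F x) g)" for g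
    by (rule square_integrable_mult(1)[OF \<alpha> sq_F])
  define \<phi> where "\<phi> g = (\<integral>x. \<alpha> x * ip (F x) g \<partial>M)" for g
  have bound: "(norm (\<phi> g))\<^sup>2 \<le> ?a * (B * (norm g)\<^sup>2)" for g
  proof -
    have "(norm (\<phi> g))\<^sup>2 \<le> ?a * (\<integral>x. (norm (ip (F x) g))\<^sup>2 \<partial>M)"
      unfolding \<phi>_def by (rule square_integrable_mult(2)[OF \<alpha> sq_F])
    also have "\<dots> \<le> ?a * (B * (norm g)\<^sup>2)"
      by (intro mult_left_mono le_F) simp
    finally show ?thesis .
  qed
  have "norm (\<phi> g) \<le> sqrt (?a * B) * norm g" for g
  proof (rule power2_le_imp_le)
    have "0 \<le> ?a * B"
      using B by simp
    then show "(norm (\<phi> g))\<^sup>2 \<le> (sqrt (?a * B) * norm g)\<^sup>2"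
      using bound[of g] by (simp add: power_mult_distrib mult.assoc)
    show "0 \<le> sqrt (?a * B) * norm g"
      using B by simp
  qed
  then have bounded: "\<And>g. g \<in> UNIV \<Longrightarrow> norm (\<phi> g) \<le> sqrt (?a * B) * norm g"
    by blast
  have add: "\<phi> (x + y) = \<phi> x + \<phi> y" for x y
    using int by (simp add: \<phi>_def ip_add_right distrib_left)
  have smul: "\<phi> (smul c x) = conjugate c * \<phi> x" for c x
    using int by (simp add: \<phi>_def ip_smul_right mult.left_commute)
  obtain v where "\<forall>g. \<phi> g = ip v g"
    by (rule Riesz_representation_on_subspace[OF subspace_UNIV add smul bounded]) auto
  then have v: "\<phi> g = ip v g" for g
    by simp
  have "has_weak_integral ip M (\<lambda>x. smul (\<alpha> x) (F x)) v"
    using int v by (simp add: has_weak_integral_def ip_smul_left \<phi>_def)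
  moreover have "(norm v)\<^sup>2 \<le> B * ?a"
  proof (cases "v = 0")
    case False
    have "norm (\<phi> v) = (norm v)\<^sup>2"
      by (simp add: v ip_self norm_power)
    then have "(norm v)\<^sup>2 * (norm v)\<^sup>2 \<le> (B * ?a) * (norm v)\<^sup>2"
      using bound[of v] by (simp add: power2_eq_square mult.commute mult.left_commute)
    then show ?thesis
      by (rule mult_right_le_imp_le) (use False in simp)
  qed (use B in simp)
  ultimately show thesis
    using that by blast
qed

text \<open>
  Linearity of a symmetric map is automatic: \<open>ip (T f) g\<close> equals \<open>ip f (T g)\<close>, which is linear in \<open>f\<close>.
\<close>

lemma bounded_linear_if_symmetric:
  assumes sym: "\<And>f g. ip (T f) g = ip f (T g)" and bound: "\<And>f. norm (T f) \<le> norm f * K"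
  shows "bounded_linear T"
proof (rule bounded_linear_intro)
  show "T (x + y) = T x + T y" for x y
    by (rule eq_if_ip_eq) (simp add: sym ip_add_left)
  show "T (r *\<^sub>R x) = r *\<^sub>R T x" for r x
    by (rule eq_if_ip_eq) (simp add: sym ip_scaleR_left)
qed (rule bound)

end

section \<open>The frame operator\<close>


locale bounded_continuous_frame = separable_hilbert_space smul ip
  for smul :: "'k::real_or_complex \<Rightarrow> 'h::{banach, second_countable_topology} \<Rightarrow> 'h"
    and ip :: "'h \<Rightarrow> 'h \<Rightarrow> 'k" +
  fixes M :: "'a measure" and F :: "'a \<Rightarrow> 'h" and A B :: real
  assumes frame: "continuous_frame_with_bounds ip M F A B"
begin

abbreviation S :: "'h \<Rightarrow> 'h" where "S \<equiv> frame_operator smul ip M F"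

lemma frame_bounds: "0 < A" "A \<le> B" "0 < B"
  using frame by (auto simp: continuous_frame_with_bounds_iff)

lemma Bessel_frame: "Bessel_with_bound M F B"
  using frame by (auto simp: continuous_frame_with_bounds_iff)

lemma lower_frame_bound: "A * (norm f)\<^sup>2 \<le> (\<integral>x. (norm (ip f (F x)))\<^sup>2 \<partial>M)"
  using frame by (auto simp: continuous_frame_with_bounds_iff)

lemma square_integrable_coefficients: "square_integrable M (\<lambda>x. ip f (F x))"
  using Bessel_frame by (simp add: Bessel_with_bound_def)

lemma has_weak_integral_frame_operator:
    "has_weak_integral ip M (\<lambda>x. smul (ip f (F x)) (F x)) (S f)" (is ?has)
  and norm_frame_operator: "(norm (S f))\<^sup>2 \<le> B * (\<integral>x. (norm (ip f (F x)))\<^sup>2 \<partial>M)" (is ?norm)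
proof -
  obtain v where v: "has_weak_integral ip M (\<lambda>x. smul (ip f (F x)) (F x)) v"
    "(norm v)\<^sup>2 \<le> B * (\<integral>x. (norm (ip f (F x)))\<^sup>2 \<partial>M)"
    using synthesis_exists[OF Bessel_frame _ square_integrable_coefficients] frame_bounds
    by (metis less_imp_le)
  have "S f = v"
    unfolding frame_operator_def weak_integral_def
    using v(1) has_weak_integral_unique by (intro the_equality)
  then show ?has ?norm
    using v by simp_all
qed

lemma ip_frame_operator: "ip (S f) g = (\<integral>x. ip f (F x) * ip (F x) g \<partial>M)"
  using has_weak_integral_frame_operator[of f] by (simp add: has_weak_integral_def ip_smul_left)

lemma frame_operator_symmetric: "ip (S f) g = ip f (S g)"
proof -
  have int: "integrable M (\<lambda>x. ip g (F x) * ip (F x) f)"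
    using has_weak_integral_frame_operator[of g] by (simp add: has_weak_integral_def ip_smul_left)
  have "ip f (S g) = conjugate (\<integral>x. ip g (F x) * ip (F x) f \<partial>M)"
    by (simp add: ip_commute[of f] ip_frame_operator)
  also have "\<dots> = (\<integral>x. conjugate (ip g (F x) * ip (F x) f) \<partial>M)"
    by (rule integral_bounded_linear[OF bounded_linear_conjugate int, symmetric])
  also have "\<dots> = (\<integral>x. ip f (F x) * ip (F x) g \<partial>M)"
    by (simp add: conjugate_mult ip_commute[symmetric] mult.commute)
  finally show ?thesis
    by (simp add: ip_frame_operator)
qed

lemma ip_frame_operator_self: "ip (S f) f = of_real (\<integral>x. (norm (ip f (F x)))\<^sup>2 \<partial>M)"
proof -
  have "ip f (F x) * ip (F x) f = of_real ((norm (ip f (F x)))\<^sup>2)" for x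
    using mult_conjugate[of "ip f (F x)"] by (simp add: ip_commute[symmetric] scaleR_conv_of_real)
  moreover have "integrable M (\<lambda>x. (norm (ip f (F x)))\<^sup>2)"
    using square_integrable_coefficients by (simp add: square_integrable_def)
  ultimately show ?thesis
    unfolding ip_frame_operator by (simp only: integral_bounded_linear[OF bounded_linear_of_real])
qed

lemma frame_operator_bounded_below: "A * norm f \<le> norm (S f)"
proof (cases "f = 0")
  case False
  have "A * (norm f)\<^sup>2 \<le> norm (ip (S f) f)"
    using lower_frame_bound[of f] by (simp add: ip_frame_operator_self)
  also have "\<dots> \<le> norm (S f) * norm f"
    by (rule ip_Cauchy_Schwarz)
  finally have "(A * norm f) * norm f \<le> norm (S f) * norm f"
    by (simp add: power2_eq_square)
  then show ?thesis
    using False by simp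
qed simp

lemma bounded_linear_frame_operator: "bounded_linear S"
proof (rule bounded_linear_if_symmetric[where K = B])
  show "ip (S f) g = ip f (S g)" for f g
    by (rule frame_operator_symmetric)
  show "norm (S f) \<le> norm f * B" for f
  proof (rule power2_le_imp_le)
    have "(norm (S f))\<^sup>2 \<le> B * (B * (norm f)\<^sup>2)"
      using Bessel_frame frame_bounds
      by (intro order_trans[OF norm_frame_operator] mult_left_mono) (auto simp: Bessel_with_bound_def)
    then show "(norm (S f))\<^sup>2 \<le> (norm f * B)\<^sup>2"
      by (simp add: power2_eq_square algebra_simps)
  qed (use frame_bounds in simp)
qed

text \<open>
  Writing \<open>e\<close> for the squared norm of the coefficients of \<open>f\<close>, which is \<open>ip (S f) f\<close>, the left-hand side
  is \<open>(norm f)\<^sup>2 - 2 e / B + (norm (S f))\<^sup>2 / B\<^sup>2\<close>. Since \<open>S f\<close> is the synthesis of these coefficients,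
  its squared norm is at most \<open>B e\<close>, and \<open>e\<close> is at least \<open>A (norm f)\<^sup>2\<close>.
\<close>

lemma norm_relaxation_step: "(norm (f - S f /\<^sub>R B))\<^sup>2 \<le> (1 - A / B) * (norm f)\<^sup>2"
proof -
  let ?e = "\<integral>x. (norm (ip f (F x)))\<^sup>2 \<partial>M"
  have ip: "ip f (S f) = of_real ?e"
    by (simp add: frame_operator_symmetric[symmetric] ip_frame_operator_self)
  have "(norm (f - S f /\<^sub>R B))\<^sup>2 = (norm f)\<^sup>2 - 2 * ?e / B + (norm (S f))\<^sup>2 / B\<^sup>2"
    using frame_bounds
    by (simp add: norm_diff_sq ip_scaleR_right ip power_mult_distrib divide_inverse power_inverse
        mult.commute flip: of_real_mult of_real_inverse)
  also have "\<dots> \<le> (norm f)\<^sup>2 - 2 * ?e / B + B * ?e / B\<^sup>2"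
    by (intro add_left_mono divide_right_mono norm_frame_operator) simp
  also have "\<dots> = (norm f)\<^sup>2 - ?e / B"
    using frame_bounds by (simp add: power2_eq_square field_simps)
  also have "\<dots> \<le> (norm f)\<^sup>2 - A * (norm f)\<^sup>2 / B"
    using frame_bounds lower_frame_bound[of f] by (intro diff_left_mono divide_right_mono) auto
  finally show ?thesis
    by (simp add: algebra_simps)
qed

text \<open>
  Surjectivity is Banach's fixed point theorem: the fixed points of \<open>f \<mapsto> f - (S f - g) / B\<close> are the
  solutions of \<open>S f = g\<close>, and the preceding estimate makes this map a contraction.
\<close>

lemma bij_frame_operator: "bij S"
proof (rule bijI)
  interpret S: bounded_linear S
    by (rule bounded_linear_frame_operator)
  have "S x = 0 \<Longrightarrow> x = 0" for x
    using frame_operator_bounded_below[of x] frame_bounds by (simp add: mult_le_0_iff)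
  then show "inj S"
    by (simp add: linear_injective_0 S.linear)
  show "surj S"
  proof (rule surjI)
    fix g
    let ?P = "\<lambda>f. f - (S f - g) /\<^sub>R B"
    define c where "c = sqrt (1 - A / B)"
    have c: "0 \<le> c" "c < 1"
      using frame_bounds by (auto simp: c_def)
    have "dist (?P x) (?P y) \<le> c * dist x y" for x y
    proof (rule power2_le_imp_le)
      have "?P x - ?P y = (x - y) - S (x - y) /\<^sub>R B"
        by (simp add: S.diff algebra_simps)
      moreover have "c\<^sup>2 = 1 - A / B"
        using frame_bounds by (simp add: c_def)
      ultimately show "(dist (?P x) (?P y))\<^sup>2 \<le> (c * dist x y)\<^sup>2"
        using norm_relaxation_step[of "x - y"] by (simp only: dist_norm power_mult_distrib)
    qed (use c in simp)
    then obtain f where "?P f = f"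
      using banach_fix_type[OF c, of ?P] by blast
    then have "S f = g"
      using frame_bounds by simp
    then show "S (SOME f. S f = g) = g"
      by (rule someI)
  qed
qed

lemma frame_operator_inv [simp]: "S (inv S f) = f" "inv S (S f) = f"
  using bij_frame_operator by (auto simp: bij_def surj_f_inv_f)

lemma inv_frame_operator_symmetric: "ip (inv S f) g = ip f (inv S g)"
  using frame_operator_symmetric[of "inv S f" "inv S g"] by simp

lemma norm_inv_frame_operator: "A * norm (inv S f) \<le> norm f"
  using frame_operator_bounded_below[of "inv S f"] by simp

lemma bounded_linear_inv_frame_operator: "bounded_linear (inv S)"
proof (rule bounded_linear_if_symmetric[where K = "1 / A"])
  show "norm (inv S f) \<le> norm f * (1 / A)" for f
    using norm_inv_frame_operator[of f] frame_bounds by (simp add: field_simps)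
qed (rule inv_frame_operator_symmetric)

text \<open>
  By symmetry of the inverse of \<open>S\<close>, the coefficients of this difference at \<open>f\<close> are those of \<open>F\<close> at
  \<open>inv S f - f\<close>.
\<close>

lemma Bessel_canonical_difference:
  "Bessel_with_bound M (\<lambda>x. inv S (F x) - F x) (B * (onorm (\<lambda>f. f - inv S f))\<^sup>2)"
  unfolding Bessel_with_bound_def
proof (intro allI)
  fix f
  let ?q = "onorm (\<lambda>f. f - inv S f)"
  have eq: "ip f (inv S (F x) - F x) = ip (inv S f - f) (F x)" for x
    by (simp add: ip_diff_left ip_diff_right inv_frame_operator_symmetric)
  have "norm (inv S f - f) \<le> ?q * norm f"
    unfolding norm_minus_commute[of "inv S f"]
    by (rule onorm) (intro bounded_linear_sub bounded_linear_ident bounded_linear_inv_frame_operator)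
  then have "(norm (inv S f - f))\<^sup>2 \<le> (?q * norm f)\<^sup>2"
    by (rule power_mono) simp
  then have "B * (norm (inv S f - f))\<^sup>2 \<le> (B * ?q\<^sup>2) * (norm f)\<^sup>2"
    using frame_bounds by (simp add: power_mult_distrib)
  then show "square_integrable M (\<lambda>x. ip f (inv S (F x) - F x)) \<and>
      (\<integral>x. (norm (ip f (inv S (F x) - F x)))\<^sup>2 \<partial>M) \<le> (B * ?q\<^sup>2) * (norm f)\<^sup>2"
    unfolding eq using Bessel_frame unfolding Bessel_with_bound_def by (meson order_trans)
qed

text \<open>
  A vector orthogonal to all \<open>F y\<close> has vanishing coefficients, hence is zero by the lower frame bound;
  so each \<open>x\<close> coincides with its projection \<open>p\<close> onto the closed span.
\<close>

lemma closure_span_frame: "closure (module.span smul (F ` space M)) = UNIV"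
proof -
  let ?V = "span (F ` space M)"
  have "x \<in> closure ?V" for x
  proof -
    obtain p where p: "p \<in> closure ?V" "\<And>g. g \<in> ?V \<Longrightarrow> ip x g = ip p g"
      by (rule Riesz_representation_on_subspace[of ?V "ip x" "norm x"])
        (auto simp: ip_add_right ip_smul_right ip_Cauchy_Schwarz)
    have "ip (x - p) (F y) = 0" if "y \<in> space M" for y
      using p(2)[OF span_base, of "F y"] that by (simp add: ip_diff_left)
    then have "(\<integral>y. (norm (ip (x - p) (F y)))\<^sup>2 \<partial>M) = (\<integral>y. 0 \<partial>M)"
      by (intro Bochner_Integration.integral_cong) auto
    then have "A * (norm (x - p))\<^sup>2 \<le> 0"
      using lower_frame_bound[of "x - p"] by simp
    then have "x = p"
      using frame_bounds by (simp add: mult_le_0_iff)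
    then show ?thesis
      using p(1) by simp
  qed
  then show ?thesis
    by auto
qed

text \<open>
  Suppose that the kernel is trivial. If \<open>\<alpha>\<close> synthesises to \<open>v\<close>, then so do the coefficients of
  \<open>w = inv S v\<close>, so both agree almost everywhere. Therefore the squared norm of \<open>\<alpha>\<close> is \<open>ip v w\<close>, at
  most \<open>(norm v)\<^sup>2 / A\<close>. This is the lower Riesz inequality, and \<open>F\<close> is a Riesz basis.
\<close>

lemma nontrivial_synthesis_kernel:
  assumes "\<not> continuous_riesz_basis smul ip M F"
  obtains h where "square_integrable M h" "\<not> (AE x in M. h x = 0)"
    "has_weak_integral ip M (\<lambda>x. smul (h x) (F x)) 0"
proof (rule ccontr)
  assume no_kernel: "\<not> thesis"
  note kernel_element = that
  have kernel_trivial: "AE x in M. h x = 0"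
    if "square_integrable M h" "has_weak_integral ip M (\<lambda>x. smul (h x) (F x)) 0" for h
    using no_kernel kernel_element[OF that(1) _ that(2)] by blast
  have "\<exists>v. has_weak_integral ip M (\<lambda>x. smul (\<alpha> x) (F x)) v \<and>
      A * (\<integral>x. (norm (\<alpha> x))\<^sup>2 \<partial>M) \<le> (norm v)\<^sup>2 \<and>
      (norm v)\<^sup>2 \<le> B * (\<integral>x. (norm (\<alpha> x))\<^sup>2 \<partial>M)"
    if \<alpha>: "square_integrable M \<alpha>" for \<alpha> :: "'a \<Rightarrow> 'k"
  proof -
    obtain v where v: "has_weak_integral ip M (\<lambda>x. smul (\<alpha> x) (F x)) v"
      "(norm v)\<^sup>2 \<le> B * (\<integral>x. (norm (\<alpha> x))\<^sup>2 \<partial>M)"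
      using synthesis_exists[OF Bessel_frame _ \<alpha>] frame_bounds by (metis less_imp_le)
    define w where "w = inv S v"
    define h where "h x = \<alpha> x - ip w (F x)" for x
    have "has_weak_integral ip M (\<lambda>x. smul (ip w (F x)) (F x)) v"
      using has_weak_integral_frame_operator[of w] by (simp add: w_def)
    then have "has_weak_integral ip M (\<lambda>x. smul (h x) (F x)) 0"
      using v(1) by (simp add: has_weak_integral_def ip_smul_left h_def left_diff_distrib)
    moreover have "square_integrable M h"
      unfolding h_def by (intro square_integrable_diff \<alpha> square_integrable_coefficients)
    ultimately have "AE x in M. h x = 0"
      by (intro kernel_trivial)
    then have "(\<integral>x. (norm (\<alpha> x))\<^sup>2 \<partial>M) = (\<integral>x. (norm (ip w (F x)))\<^sup>2 \<partial>M)"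
      using \<alpha> square_integrable_coefficients[of w]
      by (intro integral_cong_AE) (auto simp: h_def square_integrable_def)
    also have "\<dots> = norm (ip v w)"
      using ip_frame_operator_self[of w] by (simp add: w_def)
    also have "\<dots> \<le> norm v * norm w"
      by (rule ip_Cauchy_Schwarz)
    finally have "A * (\<integral>x. (norm (\<alpha> x))\<^sup>2 \<partial>M) \<le> A * (norm v * norm w)"
      using frame_bounds by simp
    also have "\<dots> \<le> norm v * norm v"
      using mult_left_mono[OF norm_inv_frame_operator[of v], of "norm v"]
      by (simp add: w_def mult.left_commute)
    finally show ?thesis
      using v by (auto simp: power2_eq_square)
  qed
  then have "continuous_riesz_basis smul ip M F"
    using frame_bounds closure_span_frame Bessel_weakly_measurable[OF Bessel_frame]
    unfolding continuous_riesz_basis_def square_integrable_def by blast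
  with assms show False
    by contradiction
qed

end

section \<open>Woven dual frames\<close>

theorem theorem3p1:
  fixes smul :: "'k::real_or_complex \<Rightarrow> 'h::{banach, second_countable_topology} \<Rightarrow> 'h"
    and ip :: "'h \<Rightarrow> 'h \<Rightarrow> 'k"
    and M :: "'a measure"
    and F :: "'a \<Rightarrow> 'h"
    and A\<^sub>F B\<^sub>F :: real
  assumes "separable_hilbert_space smul ip"
    and "\<exists>f :: 'h. f \<noteq> 0"
    and "continuous_frame_with_bounds ip M F A\<^sub>F B\<^sub>F"
    and "redundant smul ip M F"
    and "(onorm (\<lambda>f. f - inv (frame_operator smul ip M F) f))\<^sup>2 < A\<^sub>F / B\<^sub>F"
  shows "\<exists>\<G> :: ('a \<Rightarrow> 'h) set. infinite \<G> \<and>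
           pairwise (\<lambda>G G'. \<not> (AE x in M. G x = G' x)) \<G> \<and>
           (\<forall>G \<in> \<G>. dual_frame smul ip M F G \<and> continuous_woven ip M F G)"
proof -
  interpret bounded_continuous_frame smul ip M F "A\<^sub>F" "B\<^sub>F"
    using assms(1,3) by (simp add: bounded_continuous_frame_def bounded_continuous_frame_axioms_def)
  obtain u :: 'h where u: "u \<noteq> 0"
    using assms(2) by blast
  obtain h where h: "square_integrable M h" "\<not> (AE x in M. h x = 0)"
    and h_kernel: "has_weak_integral ip M (\<lambda>x. smul (h x) (F x)) 0"
    using nontrivial_synthesis_kernel assms(4) by (auto simp: redundant_def)
  define P where "P x = smul (conjugate (h x)) u" for x
  define G where "G \<epsilon> x = inv S (F x) + \<epsilon> *\<^sub>R P x" for \<epsilon> x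
  define d where "d = B\<^sub>F * (onorm (\<lambda>f. f - inv S f))\<^sup>2"
  define p where "p = (norm u)\<^sup>2 * (\<integral>x. (norm (h x))\<^sup>2 \<partial>M)"
  have d: "0 \<le> d" "d < A\<^sub>F"
    using assms(5) frame_bounds by (auto simp: d_def field_simps)
  have p: "0 \<le> p"
    by (simp add: p_def)
  have ip_P: "ip f (\<epsilon> *\<^sub>R P x) = of_real \<epsilon> * ip f u * h x" for f \<epsilon> x
    by (simp add: P_def ip_scaleR_right ip_smul_right conjugate_conjugate mult_ac)
  have Bessel_P: "Bessel_with_bound M (\<lambda>x. \<epsilon> *\<^sub>R P x) (\<epsilon>\<^sup>2 * p)" for \<epsilon>
    unfolding Bessel_with_bound_def
  proof (intro allI conjI)
    fix f
    have "(norm (ip f u))\<^sup>2 \<le> (norm f * norm u)\<^sup>2"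
      by (intro power_mono ip_Cauchy_Schwarz) simp
    then have "(\<epsilon>\<^sup>2 * (\<integral>x. (norm (h x))\<^sup>2 \<partial>M)) * (norm (ip f u))\<^sup>2 \<le>
        (\<epsilon>\<^sup>2 * (\<integral>x. (norm (h x))\<^sup>2 \<partial>M)) * (norm f * norm u)\<^sup>2"
      by (rule mult_left_mono) simp
    then show "(\<integral>x. (norm (ip f (\<epsilon> *\<^sub>R P x)))\<^sup>2 \<partial>M) \<le> \<epsilon>\<^sup>2 * p * (norm f)\<^sup>2"
      by (simp add: ip_P norm_mult power_mult_distrib p_def mult_ac)
    show "square_integrable M (\<lambda>x. ip f (\<epsilon> *\<^sub>R P x))"
      using h(1) unfolding square_integrable_def ip_P norm_mult power_mult_distrib by auto
  qed
  \<comment> \<open>With this weight \<open>(1 + s) d\<close> stays below the lower frame bound, which leaves room for the perturbation.\<close>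
  define s where "s = (A\<^sub>F - d) / (2 * A\<^sub>F)"
  have s: "0 < s"
    using d frame_bounds by (simp add: s_def)
  have "s * d \<le> s * A\<^sub>F"
    using d s by simp
  moreover have "2 * (s * A\<^sub>F) = A\<^sub>F - d"
    using frame_bounds by (simp add: s_def)
  ultimately have "d + s * d < A\<^sub>F"
    using d by linarith
  then have small: "(1 + s) * d < A\<^sub>F"
    by (simp add: distrib_right)
  have "((\<lambda>\<epsilon>. (1 + s) * d + (1 + 1 / s) * (\<epsilon>\<^sup>2 * p)) \<longlongrightarrow> (1 + s) * d + (1 + 1 / s) * (0\<^sup>2 * p)) (at 0)"
    by (intro tendsto_intros)
  then have "\<forall>\<^sub>F \<epsilon> in at 0. (1 + s) * d + (1 + 1 / s) * (\<epsilon>\<^sup>2 * p) < A\<^sub>F"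
    by (rule order_tendstoD(2)) (use small in simp)
  then obtain \<delta> where \<delta>: "0 < \<delta>"
    and \<delta>_small: "\<And>\<epsilon>. 0 < \<epsilon> \<Longrightarrow> \<epsilon> < \<delta> \<Longrightarrow> (1 + s) * d + (1 + 1 / s) * (\<epsilon>\<^sup>2 * p) < A\<^sub>F"
    by (auto simp: eventually_at)
  have woven: "continuous_woven ip M F (G \<epsilon>)" if "0 < \<epsilon>" "\<epsilon> < \<delta>" for \<epsilon>
  proof (rule continuous_woven_if_difference_small[OF frame _ _ \<delta>_small[OF that]])
    show "Bessel_with_bound M (\<lambda>x. G \<epsilon> x - F x) ((1 + s) * d + (1 + 1 / s) * (\<epsilon>\<^sup>2 * p))"
      using Bessel_add[OF Bessel_canonical_difference Bessel_P s, of "\<epsilon>"]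
      by (simp add: G_def d_def add_diff_eq add.commute)
  qed (use d p s in simp)
  have dual: "dual_frame smul ip M F (G \<epsilon>)" if "continuous_woven ip M F (G \<epsilon>)" for \<epsilon>
    unfolding dual_frame_def
  proof (intro conjI allI)
    \<comment> \<open>Gluing along the empty set leaves \<open>G \<epsilon>\<close> itself.\<close>
    show "continuous_frame ip M (G \<epsilon>)"
      using that by (force simp: continuous_woven_def continuous_frame_def)
    fix f
    have expand: "ip (smul (ip f (G \<epsilon> x)) (F x)) g =
        ip (smul (ip (inv S f) (F x)) (F x)) g + (of_real \<epsilon> * ip f u) * ip (smul (h x) (F x)) g" for g x
      by (simp add: G_def ip_smul_left ip_add_right ip_P inv_frame_operator_symmetric
          distrib_left mult_ac)
    \<comment> \<open>The canonical part reproduces \<open>S (inv S f) = f\<close>; the perturbation synthesises to a multiple of zero.\<close>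
    show "has_weak_integral ip M (\<lambda>x. smul (ip f (G \<epsilon> x)) (F x)) f"
      unfolding has_weak_integral_def expand
    proof (intro allI)
      fix g
      have "integrable M (\<lambda>x. ip (smul (ip (inv S f) (F x)) (F x)) g)"
        "(\<integral>x. ip (smul (ip (inv S f) (F x)) (F x)) g \<partial>M) = ip f g"
        "integrable M (\<lambda>x. ip (smul (h x) (F x)) g)" "(\<integral>x. ip (smul (h x) (F x)) g \<partial>M) = 0"
        using has_weak_integral_frame_operator[of "inv S f"] h_kernel
        by (simp_all add: has_weak_integral_def)
      then show "integrable M (\<lambda>x. ip (smul (ip (inv S f) (F x)) (F x)) g +
            (of_real \<epsilon> * ip f u) * ip (smul (h x) (F x)) g) \<and>
          (\<integral>x. ip (smul (ip (inv S f) (F x)) (F x)) g +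
            (of_real \<epsilon> * ip f u) * ip (smul (h x) (F x)) g \<partial>M) = ip f g"
        by simp
    qed
  qed
  have distinct: "\<not> (AE x in M. G \<epsilon> x = G \<epsilon>' x)" if "\<epsilon> \<noteq> \<epsilon>'" for \<epsilon> \<epsilon>'
  proof
    assume "AE x in M. G \<epsilon> x = G \<epsilon>' x"
    then have "AE x in M. h x = 0"
    proof eventually_elim
      case (elim x)
      then have "norm (P x) = 0"
        using \<open>\<epsilon> \<noteq> \<epsilon>'\<close> by (simp add: G_def)
      then show "h x = 0"
        using u by (simp add: P_def norm_smul)
    qed
    with h(2) show False
      by contradiction
  qed
  have "inj_on G {0<..<\<delta>}"
  proof (rule inj_onI, rule ccontr)
    fix \<epsilon> \<epsilon>'
    assume "G \<epsilon> = G \<epsilon>'" "\<epsilon> \<noteq> \<epsilon>'"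
    then show False
      using distinct[of \<epsilon> \<epsilon>'] by simp
  qed
  then have "infinite (G ` {0<..<\<delta>})"
    using infinite_Ioo[OF \<delta>] finite_imageD by blast
  moreover have "pairwise (\<lambda>G G'. \<not> (AE x in M. G x = G' x)) (G ` {0<..<\<delta>})"
    unfolding pairwise_image by (intro pairwiseI impI distinct) auto
  moreover have "\<forall>G' \<in> G ` {0<..<\<delta>}. dual_frame smul ip M F G' \<and> continuous_woven ip M F G'"
    using woven dual by simp
  ultimately show ?thesis
    by blast
qed

end
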